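(* For any integer $t\ge 2$, we have $f(r,t)\ge \sqrt{t(t-1)}^{\,r-1}$ for every odd integer $r\ge 3$, and $f(r,t)\ge \sqrt{t(t-1)}^{\,r-2}$ for every even integer $r\ge 4$.
   Context: An $r$-uniform hypergraph is a hypergraph all of whose edges have exactly $r$ vertices; it is $r$-partite if its vertex set can be partitioned into $r$ parts such that every edge contains exactly one vertex from each part. A matching is a collection of pairwise disjoint edges; its size is the number of edges. Given matchings $M_1,\dots,M_N$ in the same hypergraph, a rainbow matching of size $t$ consists of pairwise disjoint edges $e_1\in M_{i_1},\dots,e_t\in M_{i_t}$ with distinct indices $i_1,\dots,i_t\in\{1,\dots,N\}$. $f(r,t)$ denotes the maximum possible number $N$ of matchings $M_1,\dots,M_N$ of size $t$ in some $r$-partite $r$-uniform hypergraph such that there is no rainbow matching of size $t$. *)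

theory Defs
  imports Complex_Main "HOL-Library.Disjoint_Sets"
begin

definition hypergraph :: "'a set \<Rightarrow> 'a set set \<Rightarrow> bool" where
  "hypergraph V E \<longleftrightarrow> finite V \<and> E \<subseteq> Pow V"

definition uniform :: "nat \<Rightarrow> 'a set set \<Rightarrow> bool" where
  "uniform r E \<longleftrightarrow> (\<forall>e\<in>E. card e = r)"

definition partite :: "nat \<Rightarrow> 'a set \<Rightarrow> 'a set set \<Rightarrow> bool" where
  "partite r V E \<longleftrightarrow>
     (\<exists>P :: nat \<Rightarrow> 'a set. disjoint_family_on P {1..r} \<and> (\<Union>i\<in>{1..r}. P i) = V \<and>
        (\<forall>e\<in>E. \<forall>i\<in>{1..r}. card (e \<inter> P i) = 1))"

definition matching :: "'a set set \<Rightarrow> 'a set set \<Rightarrow> bool" where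
  "matching E M \<longleftrightarrow> M \<subseteq> E \<and> disjoint M"

definition rainbow_matching :: "nat \<Rightarrow> (nat \<Rightarrow> 'a set set) \<Rightarrow> nat \<Rightarrow> (nat \<Rightarrow> nat) \<Rightarrow> (nat \<Rightarrow> 'a set) \<Rightarrow> bool" where
  "rainbow_matching N M t i e \<longleftrightarrow>
     inj_on i {1..t} \<and> i ` {1..t} \<subseteq> {1..N} \<and>
     (\<forall>j\<in>{1..t}. e j \<in> M (i j)) \<and> disjoint_family_on e {1..t}"

(* The matchings form a family indexed by {1..N}, so repetitions are allowed.
   Finitely many matchings only involve finitely many vertices, so taking the
   vertices to be natural numbers loses no generality. *)
definition rainbow_free_family :: "nat \<Rightarrow> nat \<Rightarrow> nat \<Rightarrow> bool" where
  "rainbow_free_family r t N \<longleftrightarrow>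
     (\<exists>(V :: nat set) E (M :: nat \<Rightarrow> nat set set).
        hypergraph V E \<and> uniform r E \<and> partite r V E \<and>
        (\<forall>k\<in>{1..N}. matching E (M k) \<and> card (M k) = t) \<and>
        \<not> (\<exists>i e. rainbow_matching N M t i e))"

(* For r, t \<ge> 1 the set below contains 0 and is bounded, so Max is a genuine maximum:
   among sufficiently many matchings there are t whose vertex sets pairwise intersect
   in one common set (by the sunflower lemma) and whose edges leave the same traces
   on it, and these t matchings admit a rainbow matching of size t. *)
definition rainbow_f :: "nat \<Rightarrow> nat \<Rightarrow> nat" where
  "rainbow_f r t = Max {N. rainbow_free_family r t N}"

end

theory Submission
  imports Defs "HOL-Library.Ramsey" "HOL-Library.Nat_Bijection" "HOL-Combinatorics.Transposition"
begin

text \<open>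
  Let \<open>s = (r - 1) div 2\<close>. The colours are the words of length \<open>s\<close> over the alphabet of ordered
  pairs \<open>(i, j)\<close> with \<open>i \<noteq> j\<close> and \<open>i, j < t\<close>. All parts have \<open>t\<close> vertices. The edges of a colour
  are indexed by their vertex \<open>x < t\<close> in the first part, and every letter \<open>(i, j)\<close> of the word
  governs the two further parts \<open>2c + 2\<close> and \<open>2c + 3\<close> (\<open>c\<close> being its position, counted from 0),
  in which the edges \<open>0\<close> and \<open>1\<close> have the vertices \<open>(i, j)\<close> and \<open>(j, i)\<close>,
  whereas each edge \<open>x \<ge> 2\<close> uses the same vertex in both. In a matching of size \<open>t\<close> all vertices are
  covered, so in both parts the edges \<open>0\<close> and \<open>1\<close> leave the same vertices to the others. This
  forces the edges \<open>0\<close> and \<open>1\<close> to have the same letter at each position, hence the same colour.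
  Any remaining part is a copy of the first one.

  For the maximum to dominate the number of colours, the size of rainbow-free families must also
  be bounded, which is a consequence of Ramsey's theorem.
\<close>

section \<open>Boundedness of rainbow-free families\<close>

text \<open>Reading \<open>c\<close> at \<open>Min S\<close> and \<open>Max S\<close> turns it into
  a colouring of 2-subsets, so only pairs with \<open>k < l\<close> are controlled. \<open>B\<close>
  is chosen before \<open>c\<close> because it has to serve all families at once.\<close>

lemma ramsey_ordered_pairs:
  assumes "finite C"
  shows "\<exists>B. \<forall>c :: nat \<Rightarrow> nat \<Rightarrow> 'c. (\<forall>k l. c k l \<in> C) \<longrightarrow>
    (\<exists>H\<subseteq>{..<B}. card H = m \<and> (\<exists>R. \<forall>k\<in>H. \<forall>l\<in>H. k < l \<longrightarrow> c k l = R))"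
proof -
  obtain B :: nat where B: "partn_lst {..<B} (replicate (card C) m) 2"
    using ramsey_full[of "replicate (card C) m" 2] by blast
  obtain h where h: "bij_betw h C {0..<card C}"
    using ex_bij_betw_finite_nat[OF assms] by blast
  show ?thesis
  proof (intro exI[of _ B] allI impI)
    fix c :: "nat \<Rightarrow> nat \<Rightarrow> 'c" assume c: "\<forall>k l. c k l \<in> C"
    define f where "f S = h (c (Min S) (Max S))" for S
    have "f \<in> nsets {..<B} 2 \<rightarrow> {..<card C}"
      using bij_betwE[OF h] c by (auto simp: f_def)
    from partn_lstE[OF B this] obtain i H where
      i: "i < card C" and H: "H \<in> nsets {..<B} (replicate (card C) m ! i)" and Hf: "f ` nsets H 2 \<subseteq> {i}"
      by auto
    have "c k l = inv_into C h i" if "k \<in> H" "l \<in> H" "k < l" for k l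
    proof -
      have "{k, l} \<in> nsets H 2" using that by simp
      then have "f {k, l} = i" using Hf by blast
      then have "h (c k l) = i" using \<open>k < l\<close> by (simp add: f_def)
      then show ?thesis using h c by (metis bij_betw_imp_inj_on inv_into_f_f)
    qed
    then show "\<exists>H\<subseteq>{..<B}. card H = m \<and> (\<exists>R. \<forall>k\<in>H. \<forall>l\<in>H. k < l \<longrightarrow> c k l = R)"
      using H i by (auto simp: nsets_def)
  qed
qed

text \<open>Colour a pair of matchings by the triples \<open>(a, b, p)\<close> for which edge
  \<open>a\<close> of the first and edge \<open>b\<close> of the second agree in part
  \<open>p\<close>. On a homogeneous set all these triples have \<open>a = b\<close>, so picking a
  different edge index in each of \<open>t\<close> matchings yields disjoint edges.\<close>

lemma rainbow_free_family_bounded: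
  assumes "t \<ge> 1"
  shows "\<exists>B. \<forall>N. rainbow_free_family r t N \<longrightarrow> N \<le> B"
proof -
  define T where "T = {1..t} \<times> {1..t} \<times> {1..r}"
  have "finite (Pow T)" by (simp add: T_def)
  \<comment> \<open>Size \<open>t + 3\<close> covers both uses of the homogeneous set: three
    elements for \<open>diag\<close>, and \<open>t\<close> for the rainbow matching.\<close>
  from ramsey_ordered_pairs[OF this, of "t + 3"] obtain B where
    B: "\<And>c :: nat \<Rightarrow> nat \<Rightarrow> (nat \<times> nat \<times> nat) set. (\<forall>k l. c k l \<in> Pow T) \<Longrightarrow>
      \<exists>H\<subseteq>{..<B}. card H = t + 3 \<and> (\<exists>R. \<forall>k\<in>H. \<forall>l\<in>H. k < l \<longrightarrow> c k l = R)"
    by blast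
  have "N \<le> B" if "rainbow_free_family r t N" for N
  proof (rule ccontr)
    assume "\<not> N \<le> B"
    from that obtain V :: "nat set" and E M where
      V: "hypergraph V E" and "partite r V E"
      and M: "\<And>k. k \<in> {1..N} \<Longrightarrow> matching E (M k) \<and> card (M k) = t"
      and rf: "\<not> (\<exists>i e. rainbow_matching N M t i e)"
      unfolding rainbow_free_family_def by blast
    then obtain P where P: "(\<Union>p\<in>{1..r}. P p) = V"
      and P1: "\<And>e p. e \<in> E \<Longrightarrow> p \<in> {1..r} \<Longrightarrow> card (e \<inter> P p) = 1"
      unfolding partite_def by blast
    define v where "v e p = the_elem (e \<inter> P p)" for e p
    have v: "e \<inter> P p = {v e p}" if "e \<in> E" "p \<in> {1..r}" for e p
      using P1[OF that] by (metis card_1_singletonE the_elem_eq v_def)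
    have "\<exists>f. bij_betw f {1..t} (M k)" if "k \<in> {1..N}" for k
      using ex_bij_betw_nat_finite_1[of "M k"] card_ge_0_finite[of "M k"] M[OF that] assms by auto
    then have "\<forall>k\<in>{1..N}. \<exists>f. bij_betw f {1..t} (M k)" by blast
    from bchoice[OF this] obtain f where f: "\<And>k. k \<in> {1..N} \<Longrightarrow> bij_betw (f k) {1..t} (M k)" by blast
    have fM: "f k a \<in> M k" if "k \<in> {1..N}" "a \<in> {1..t}" for k a
      using f that bij_betwE by blast
    have fE: "f k a \<in> E" if "k \<in> {1..N}" "a \<in> {1..t}" for k a
      using fM[OF that] M[OF that(1)] by (auto simp: matching_def)
    \<comment> \<open>\<open>Suc\<close> shifts the Ramsey ground set, which starts at 0, to the
      matching indices, which start at 1.\<close>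
    define c where "c k l = {(a, b, p) \<in> T. v (f (Suc k) a) p = v (f (Suc l) b) p}" for k l
    have "\<forall>k l. c k l \<in> Pow T" by (auto simp: c_def)
    from B[OF this] obtain H R where H: "H \<subseteq> {..<B}" "card H = t + 3"
      and R: "\<And>k l. k \<in> H \<Longrightarrow> l \<in> H \<Longrightarrow> k < l \<Longrightarrow> c k l = R" by metis
    have Suc_in: "Suc k \<in> {1..N}" if "k \<in> H" for k
      using that H \<open>\<not> N \<le> B\<close> by auto
    \<comment> \<open>For \<open>k1 < k2 < k3\<close> in \<open>H\<close>, the \<open>p\<close>-vertices of the edges \<open>a\<close> and \<open>b\<close> of the matching \<open>k2\<close>
      both equal the \<open>p\<close>-vertex of edge \<open>b\<close> of the matching \<open>k3\<close>.\<close>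
    have diag: "a = b" if "(a, b, p) \<in> R" for a b p
    proof -
      obtain H' where "H' \<subseteq> H" "card H' = 3" "finite H'"
        using obtain_subset_with_card_n[of 3 H] H by auto
      then have "H' \<in> nsets H 3" by (simp add: nsets_def)
      then obtain k1 k2 k3 where k: "k1 \<in> H" "k2 \<in> H" "k3 \<in> H" "k1 < k2" "k2 < k3"
        unfolding ordered_nsets_3_eq by blast
      have in3: "(a, b, p) \<in> c k1 k2" "(a, b, p) \<in> c k1 k3" "(a, b, p) \<in> c k2 k3"
        using R k that by auto
      then have ab: "a \<in> {1..t}" "b \<in> {1..t}" "p \<in> {1..r}" by (auto simp: c_def T_def)
      have "v (f (Suc k2) a) p = v (f (Suc k2) b) p"
        using in3 by (auto simp: c_def)
      then have "f (Suc k2) a \<inter> f (Suc k2) b \<noteq> {}"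
        using v[OF fE[OF Suc_in[OF k(2)] ab(1)] ab(3)] v[OF fE[OF Suc_in[OF k(2)] ab(2)] ab(3)] by auto
      moreover have "disjoint (M (Suc k2))"
        using M[OF Suc_in[OF k(2)]] by (simp add: matching_def)
      ultimately have "f (Suc k2) a = f (Suc k2) b"
        using fM[OF Suc_in[OF k(2)]] ab by (meson disjointD)
      then show "a = b"
        using f[OF Suc_in[OF k(2)]] ab by (meson bij_betw_imp_inj_on inj_onD)
    qed
    \<comment> \<open>A common vertex lies in some part \<open>p\<close>, where each edge has a
      single vertex. Hence \<open>(a, b, p)\<close> is in \<open>R\<close>, against
      \<open>diag\<close>.\<close>
    have disj: "f (Suc k) a \<inter> f (Suc l) b = {}"
      if "k \<in> H" "l \<in> H" "k < l" "a \<in> {1..t}" "b \<in> {1..t}" "a \<noteq> b" for k l a b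
    proof (rule ccontr)
      assume "f (Suc k) a \<inter> f (Suc l) b \<noteq> {}"
      then obtain u where u: "u \<in> f (Suc k) a" "u \<in> f (Suc l) b" by blast
      have kE: "f (Suc k) a \<in> E" "f (Suc l) b \<in> E" using fE Suc_in that by auto
      then have "u \<in> V" using V u by (auto simp: hypergraph_def)
      then obtain p where p: "p \<in> {1..r}" "u \<in> P p" using P by blast
      have "v (f (Suc k) a) p = v (f (Suc l) b) p"
        using v[OF kE(1) p(1)] v[OF kE(2) p(1)] u p by (metis IntI singletonD)
      then have "(a, b, p) \<in> c k l" using that p by (auto simp: c_def T_def)
      then show False using R diag that by blast
    qed
    obtain H' where H': "H' \<subseteq> H" "card H' = t" "finite H'"
      using obtain_subset_with_card_n[of t H] H by auto
    obtain g where g: "bij_betw g {1..t} H'"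
      using ex_bij_betw_nat_finite_1[OF H'(3)] H' by auto
    have gH: "g j \<in> H" if "j \<in> {1..t}" for j
      using bij_betwE[OF g] that H' by blast
    have "rainbow_matching N M t (\<lambda>j. Suc (g j)) (\<lambda>j. f (Suc (g j)) j)"
      unfolding rainbow_matching_def
    proof (intro conjI)
      show "inj_on (\<lambda>j. Suc (g j)) {1..t}"
        using inj_onD[OF bij_betw_imp_inj_on[OF g]] by (intro inj_onI) blast
      show "(\<lambda>j. Suc (g j)) ` {1..t} \<subseteq> {1..N}" using Suc_in gH by blast
      show "\<forall>j\<in>{1..t}. f (Suc (g j)) j \<in> M (Suc (g j))" using fM Suc_in gH by blast
      show "disjoint_family_on (\<lambda>j. f (Suc (g j)) j) {1..t}"
        unfolding disjoint_family_on_def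
      proof (intro ballI impI)
        fix a b assume ab: "a \<in> {1..t}" "b \<in> {1..t}" "a \<noteq> b"
        then have "g a \<noteq> g b" using inj_on_eq_iff[OF bij_betw_imp_inj_on[OF g]] by simp
        then consider "g a < g b" | "g b < g a" by linarith
        then show "f (Suc (g a)) a \<inter> f (Suc (g b)) b = {}"
          using disj[OF gH gH] ab by cases blast+
      qed
    qed
    then show False using rf by blast
  qed
  then show ?thesis by blast
qed

lemma rainbow_f_ge:
  assumes "t \<ge> 1" "rainbow_free_family r t N"
  shows "N \<le> rainbow_f r t"
  unfolding rainbow_f_def
proof (rule Max_ge)
  obtain B where "\<And>N. rainbow_free_family r t N \<Longrightarrow> N \<le> B"
    using rainbow_free_family_bounded[OF assms(1)] by blast
  then show "finite {N. rainbow_free_family r t N}"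
    by (metis finite_nat_set_iff_bounded_le mem_Collect_eq)
qed (use assms in simp)

section \<open>The construction\<close>

definition letters :: "nat \<Rightarrow> (nat \<times> nat) set" where
  "letters t = {..<t} \<times> {..<t} - (\<lambda>i. (i, i)) ` {..<t}"

lemma card_letters: "card (letters t) = t * (t - 1)"
proof -
  have "card (letters t) = t * t - card ((\<lambda>i. (i, i)) ` {..<t})"
    unfolding letters_def by (subst card_Diff_subset) auto
  also have "card ((\<lambda>i. (i, i)) ` {..<t}) = t"
    by (subst card_image) (auto simp: inj_on_def)
  finally show ?thesis by (simp add: diff_mult_distrib2)
qed

text \<open>For distinct entries this is a permutation taking 0 and 1 to the entries of
  \<open>a\<close>: the first swap sends 0 to \<open>fst a\<close>, and the second sends the current
  image of 1 to \<open>snd a\<close> without touching \<open>fst a\<close>.\<close>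

definition place :: "nat \<times> nat \<Rightarrow> nat \<Rightarrow> nat" where
  "place a = transpose (transpose 0 (fst a) 1) (snd a) \<circ> transpose 0 (fst a)"

lemma inj_place: "inj (place a)"
  unfolding place_def by (intro inj_compose) auto

lemma place_0: "a \<in> letters t \<Longrightarrow> place a 0 = fst a"
  by (cases a) (auto simp: place_def letters_def transpose_def)

lemma place_1: "place a 1 = snd a"
  by (simp add: place_def)

text \<open>Only 0, 1 and the entries of \<open>a\<close> can move; two distinct entries below
  \<open>t\<close> force \<open>1 < t\<close>.\<close>

lemma place_less: "a \<in> letters t \<Longrightarrow> x < t \<Longrightarrow> place a x < t"
  by (cases a) (auto simp: place_def letters_def transpose_def)

text \<open>Swapping 0 and 1 before the same permutation exchanges the vertices of the edges 0 and 1
  and keeps all others. The default \<open>x\<close> serves part 1 and any part beyond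
  \<open>2 * s + 1\<close>.\<close>

definition label :: "nat \<Rightarrow> (nat \<Rightarrow> nat \<times> nat) \<Rightarrow> nat \<Rightarrow> nat \<Rightarrow> nat" where
  "label s w x p =
     (if p \<in> {2..2 * s + 1}
      then place (w ((p - 2) div 2)) (if even p then x else transpose 0 1 x) else x)"

text \<open>Tagging each vertex with its part makes the parts disjoint; \<open>prod_encode\<close>
  keeps vertices natural numbers.\<close>

definition word_edge :: "nat \<Rightarrow> nat \<Rightarrow> (nat \<Rightarrow> nat \<times> nat) \<Rightarrow> nat \<Rightarrow> nat set" where
  "word_edge r s w x = (\<lambda>p. prod_encode (p, label s w x p)) ` {1..r}"

lemma label_eq_iff: "label s w x p = label s w y p \<longleftrightarrow> x = y"
  by (auto simp: label_def inj_eq[OF inj_place] inj_eq[OF inj_transpose])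

lemma label_less:
  assumes "w \<in> {..<s} \<rightarrow>\<^sub>E letters t" "x < t" "t \<ge> 2"
  shows "label s w x p < t"
proof (cases "p \<in> {2..2 * s + 1}")
  case True
  then have "(p - 2) div 2 < s" by auto
  then have "w ((p - 2) div 2) \<in> letters t" using PiE_mem[OF assms(1)] by simp
  moreover have "transpose 0 1 x < t" using assms by (simp add: transpose_def)
  ultimately show ?thesis using True assms(2) by (simp add: label_def place_less)
next
  case False
  then show ?thesis unfolding label_def using assms(2) by (simp only: if_False)
qed

lemma label_even:
  assumes "c < s"
  shows "label s w x (2 * c + 2) = place (w c) x"
  using assms by (simp add: label_def)

lemma label_odd:
  assumes "c < s"
  shows "label s w x (2 * c + 3) = place (w c) (transpose 0 1 x)"
proof -
  have "(2 * c + 3 - 2) div 2 = c" by simp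
  then show ?thesis using assms by (simp add: label_def)
qed

lemma word_edge_disjoint:
  assumes "word_edge r s w x \<inter> word_edge r s w' y = {}" "p \<in> {1..r}"
  shows "label s w x p \<noteq> label s w' y p"
proof
  have mem: "prod_encode (p, label s w x p) \<in> word_edge r s w x" for w x
    unfolding word_edge_def by (rule image_eqI[OF refl assms(2)])
  assume "label s w x p = label s w' y p"
  then have "prod_encode (p, label s w x p) \<in> word_edge r s w' y"
    using mem[of w' y] by simp
  then show False using assms(1) mem[of w x] by blast
qed

lemma word_edge_Int:
  assumes "p \<in> {1..r}" "label s w x p < t"
  shows "word_edge r s w x \<inter> (\<lambda>y. prod_encode (p, y)) ` {..<t} = {prod_encode (p, label s w x p)}"
  using assms by (auto simp: word_edge_def)

lemma word_edge_inj:
  assumes "word_edge r s w x \<inter> word_edge r s w y \<noteq> {}"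
  shows "x = y"
  using assms by (auto simp: word_edge_def label_eq_iff)

lemma word_edge_nonempty: "r \<ge> 1 \<Longrightarrow> word_edge r s w x \<noteq> {}"
  by (auto simp: word_edge_def)

text \<open>Here \<open>J\<close> indexes the chosen edges, \<open>w j\<close> is the colour of the
  \<open>j\<close>-th one and \<open>x j\<close> its position in its matching. The hypothesis
  \<open>inj\<close> expresses disjointness within part \<open>p\<close>.\<close>

lemma colour_of_edges_0_1:
  assumes x: "bij_betw x J {..<t}" and "t \<ge> 2"
    and w: "\<And>j. j \<in> J \<Longrightarrow> w j \<in> {..<s} \<rightarrow>\<^sub>E letters t"
    and inj: "\<And>p. p \<in> {1..2 * s + 1} \<Longrightarrow> inj_on (\<lambda>j. label s (w j) (x j) p) J"
    and j: "j0 \<in> J" "j1 \<in> J" "x j0 = 0" "x j1 = 1"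
  shows "w j0 = w j1"
proof (rule PiE_ext[OF w[OF j(1)] w[OF j(2)]])
  fix c assume "c \<in> {..<s}"
  then have c: "c < s" by simp
  define y where "y j = label s (w j) (x j) (2 * c + 2)" for j
  define z where "z j = label s (w j) (x j) (2 * c + 3)" for j
  have fin: "finite J" and card: "card J = t"
    using x bij_betw_finite bij_betw_same_card by fastforce+
  have xt: "x j < t" if "j \<in> J" for j using bij_betwE[OF x] that by auto
  have yi: "inj_on y J" and zi: "inj_on z J"
    using inj[of "2 * c + 2"] inj[of "2 * c + 3"] c by (simp_all add: y_def[abs_def] z_def[abs_def])
  have onto: "u ` J = {..<t}" if "inj_on u J" "\<And>j. j \<in> J \<Longrightarrow> u j < t" for u
    by (rule card_subset_eq) (use that card in \<open>auto simp: card_image\<close>)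
  have y: "y ` J = {..<t}" and z: "z ` J = {..<t}"
    using onto[OF yi] onto[OF zi] label_less[OF w xt \<open>t \<ge> 2\<close>] by (auto simp: y_def z_def)
  define D where "D = J - {j0, j1}"
  have "y j = z j" if "j \<in> D" for j
  proof -
    have "j \<in> J" "j \<noteq> j0" "j \<noteq> j1" using that by (auto simp: D_def)
    then have "x j \<noteq> 0" "x j \<noteq> 1"
      using j inj_on_eq_iff[OF bij_betw_imp_inj_on[OF x], of j] by metis+
    then show ?thesis unfolding y_def z_def label_even[OF c] label_odd[OF c] by simp
  qed
  then have "y ` D = z ` D" by simp
  moreover have "J - D = {j0, j1}" "D \<subseteq> J" using j by (auto simp: D_def)
  \<comment> \<open>Both parts are fully covered and agree on \<open>D\<close>, so \<open>j0\<close>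
    and \<open>j1\<close> share the same leftover vertices in each.\<close>
  then have "y ` {j0, j1} = y ` J - y ` D" "z ` {j0, j1} = z ` J - z ` D"
    using inj_on_image_set_diff[OF yi, of J D] inj_on_image_set_diff[OF zi, of J D] j by simp_all
  ultimately have yz: "{y j0, y j1} = {z j0, z j1}" using y z by simp
  have L: "w j0 c \<in> letters t" "w j1 c \<in> letters t"
    using w[OF j(1)] w[OF j(2)] c by auto
  have "y j0 = fst (w j0 c)" "z j0 = snd (w j0 c)" "y j1 = snd (w j1 c)" "z j1 = fst (w j1 c)"
    unfolding y_def z_def label_even[OF c] label_odd[OF c] j(3,4)
    using place_0[OF L(1)] place_0[OF L(2)] place_1 by simp_all
  \<comment> \<open>For letters \<open>(a, b)\<close> and \<open>(a', b')\<close> this reads {a, b'}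
    = {b, a'}; since a and b differ, a = a' and b = b'.\<close>
  with yz have "{fst (w j0 c), snd (w j1 c)} = {snd (w j0 c), fst (w j1 c)}" by simp
  moreover have "fst (w j0 c) \<noteq> snd (w j0 c)" using L by (auto simp: letters_def)
  ultimately show "w j0 c = w j1 c" by (metis doubleton_eq_iff prod_eqI)
qed

lemma rainbow_free_family_words:
  assumes "t \<ge> 2" "2 * s + 1 \<le> r"
  shows "rainbow_free_family r t ((t * (t - 1)) ^ s)"
proof -
  define W where "W = ({..<s} \<rightarrow>\<^sub>E letters t)"
  define N where "N = (t * (t - 1)) ^ s"
  have "card W = N" by (simp add: W_def N_def card_PiE card_letters)
  moreover have "finite W" by (simp add: W_def letters_def finite_PiE)
  ultimately obtain g where g: "bij_betw g {1..N} W"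
    using ex_bij_betw_nat_finite_1 by blast
  have gW: "g k \<in> {..<s} \<rightarrow>\<^sub>E letters t" if "k \<in> {1..N}" for k
    using bij_betwE[OF g] that by (auto simp: W_def)
  define E where "E = (\<Union>w\<in>W. word_edge r s w ` {..<t})"
  define P where "P p = (\<lambda>y. prod_encode (p, y)) ` {..<t}" for p
  define V where "V = (\<Union>p\<in>{1..r}. P p)"
  define M where "M k = word_edge r s (g k) ` {..<t}" for k
  have "r \<ge> 1" using assms by simp
  have "word_edge r s w x \<subseteq> V" if "w \<in> W" "x < t" for w x
    using label_less[OF _ that(2) assms(1)] that(1) by (auto simp: V_def P_def W_def word_edge_def)
  then have hyp: "hypergraph V E"
    by (auto simp: hypergraph_def E_def) (simp add: V_def P_def)
  have "card (word_edge r s w x) = r" for w x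
    unfolding word_edge_def by (subst card_image) (auto simp: inj_on_def)
  then have unif: "uniform r E" by (auto simp: uniform_def E_def)
  have part: "partite r V E"
    unfolding partite_def
  proof (intro exI[of _ P] conjI)
    show "disjoint_family_on P {1..r}" by (auto simp: disjoint_family_on_def P_def)
    show "\<forall>e\<in>E. \<forall>p\<in>{1..r}. card (e \<inter> P p) = 1"
      using label_less[OF _ _ assms(1)] by (auto simp: E_def P_def W_def word_edge_Int)
  qed (simp add: V_def)
  have mat: "matching E (M k) \<and> card (M k) = t" if "k \<in> {1..N}" for k
  proof -
    have "inj_on (word_edge r s (g k)) {..<t}"
      using word_edge_inj word_edge_nonempty[OF \<open>r \<ge> 1\<close>] by (metis inf.idem inj_onI)
    then have "card (M k) = t" by (simp add: M_def card_image)
    moreover have "disjoint (M k)"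
      unfolding M_def by (rule disjointI) (use word_edge_inj in blast)
    moreover have "M k \<subseteq> E" using bij_betwE[OF g] that unfolding M_def E_def by blast
    ultimately show ?thesis by (simp add: matching_def)
  qed
  have "\<not> rainbow_matching N M t i e" for i e
  proof
    assume "rainbow_matching N M t i e"
    then have i: "inj_on i {1..t}" "i ` {1..t} \<subseteq> {1..N}"
      and e: "\<forall>j\<in>{1..t}. e j \<in> M (i j)" and disj: "disjoint_family_on e {1..t}"
      by (auto simp: rainbow_matching_def)
    from e have "\<forall>j\<in>{1..t}. \<exists>x<t. e j = word_edge r s (g (i j)) x" by (auto simp: M_def)
    then obtain x where x: "\<And>j. j \<in> {1..t} \<Longrightarrow> x j < t"
      and ex: "\<And>j. j \<in> {1..t} \<Longrightarrow> e j = word_edge r s (g (i j)) (x j)" by metis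
    have inj: "inj_on (\<lambda>j. label s (g (i j)) (x j) p) {1..t}" if "p \<in> {1..r}" for p
      using disj ex word_edge_disjoint[OF _ that] unfolding inj_on_def disjoint_family_on_def
      by metis
    \<comment> \<open>In part 1 the label is the position itself, so every position, in particular 0
      and 1, occurs exactly once.\<close>
    have "inj_on x {1..t}"
      using inj[of 1] \<open>r \<ge> 1\<close> by (simp add: label_def)
    moreover from this have "x ` {1..t} = {..<t}"
      by (intro card_subset_eq) (use x in \<open>auto simp: card_image\<close>)
    ultimately have bij: "bij_betw x {1..t} {..<t}" by (simp add: bij_betw_def)
    have "0 \<in> x ` {1..t}" "1 \<in> x ` {1..t}"
      using assms \<open>x ` {1..t} = {..<t}\<close> by simp_all
    then obtain j0 j1 where j: "j0 \<in> {1..t}" "j1 \<in> {1..t}" "x j0 = 0" "x j1 = 1"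
      by (metis imageE)
    have "g (i j) \<in> {..<s} \<rightarrow>\<^sub>E letters t" if "j \<in> {1..t}" for j
      using gW i(2) that by blast
    moreover have "inj_on (\<lambda>j. label s (g (i j)) (x j) p) {1..t}" if "p \<in> {1..2 * s + 1}" for p
      using inj that assms(2) by simp
    ultimately have "g (i j0) = g (i j1)"
      using colour_of_edges_0_1[where w = "\<lambda>j. g (i j)", OF bij assms(1) _ _ j] by blast
    \<comment> \<open>Distinct indices carry distinct colours, as \<open>g\<close> and
      \<open>i\<close> are injective.\<close>
    then have "j0 = j1"
      using inj_onD[OF bij_betw_imp_inj_on[OF g]] inj_onD[OF i(1)] i(2) j(1,2)
      by (meson image_subset_iff)
    then show False using j by simp
  qed
  then show ?thesis
    unfolding rainbow_free_family_def N_def[symmetric] using hyp unif part mat by blast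
qed

lemma rainbow_f_ge_power:
  assumes "t \<ge> 2" "2 * s + 1 \<le> r"
  shows "real (rainbow_f r t) \<ge> sqrt (real t * (real t - 1)) ^ (2 * s)"
proof -
  have "sqrt (real t * (real t - 1)) ^ (2 * s) = (real t * (real t - 1)) ^ s"
    using assms by (simp add: power_mult)
  also have "\<dots> = real ((t * (t - 1)) ^ s)"
    using assms by (simp add: of_nat_diff)
  also have "\<dots> \<le> real (rainbow_f r t)"
    using rainbow_f_ge[OF _ rainbow_free_family_words[OF assms]] assms(1) by (intro of_nat_mono) simp
  finally show ?thesis .
qed

theorem theorem4p19:
  fixes t :: nat
  assumes "t \<ge> 2"
  shows "(\<forall>r::nat. odd r \<and> r \<ge> 3 \<longrightarrow>
            real (rainbow_f r t) \<ge> sqrt (real t * (real t - 1)) ^ (r - 1)) \<and>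
         (\<forall>r::nat. even r \<and> r \<ge> 4 \<longrightarrow>
            real (rainbow_f r t) \<ge> sqrt (real t * (real t - 1)) ^ (r - 2))"
proof (intro conjI allI impI)
  fix r :: nat assume r: "odd r \<and> r \<ge> 3"
  then have "2 * ((r - 1) div 2) = r - 1" by simp
  then show "real (rainbow_f r t) \<ge> sqrt (real t * (real t - 1)) ^ (r - 1)"
    using rainbow_f_ge_power[OF assms, of "(r - 1) div 2" r] r by simp
next
  fix r :: nat assume r: "even r \<and> r \<ge> 4"
  \<comment> \<open>For even \<open>r\<close> the part \<open>r\<close> is left over and copies part
    1.\<close>
  then have "2 * ((r - 2) div 2) = r - 2" "r - 2 + 1 \<le> r" by auto
  then show "real (rainbow_f r t) \<ge> sqrt (real t * (real t - 1)) ^ (r - 2)"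
    using rainbow_f_ge_power[OF assms, of "(r - 2) div 2" r] by simp
qed

end
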